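(* Let $n\ge 2$, let $\lambda_1=\lambda_1(\mathbb{H}^n)=\frac{(n-1)^2}{4}$, and let $\Omega\subsetneq\mathbb{H}^n$ be a domain such that $H^{(n-1)/2}(\partial_\infty\Omega)=0$. Then for every $\lambda\in[0,\lambda_1]$ there is no bounded $\lambda$-harmonic function of $\Omega$; that is, every bounded $u\in C(\overline{\Omega})\cap C^2(\Omega)$ with $-\Delta u=\lambda u$ in $\Omega$ and $u=0$ on $\partial\Omega$ is identically zero.
   Context: $\mathbb{H}^n$ is hyperbolic $n$-space, $\Delta$ its Laplace–Beltrami operator, and $\lambda_1(\mathbb{H}^n)=(n-1)^2/4$ the bottom of its spectrum. A domain is an open connected set. For a domain $\Omega\neq\mathbb{H}^n$, a $\lambda$-harmonic function of $\Omega$ is a nontrivial $u\in C(\overline\Omega)\cap C^2(\Omega)$ with $-\Delta u=\lambda u$ in $\Omega$ and $u=0$ on $\partial\Omega$. The asymptotic boundary $\partial_\infty\mathbb{H}^n$ is the set of equivalence classes of unit-speed geodesic rays, two rays being equivalent iff $d(\gamma_1(t),\gamma_2(t))$ stays bounded; $\overline{\mathbb{H}^n}=\mathbb{H}^n\cup\partial_\infty\mathbb{H}^n$ carries the cone topology (generated by open subsets of $\mathbb{H}^n$ and truncated cones). For $\Omega\subset\mathbb{H}^n$, $\partial_\infty\Omega$ is the boundary of $\Omega$ in $\overline{\mathbb{H}^n}$ (cone topology) minus its boundary in $\mathbb{H}^n$. In the Poincaré ball model ($B=\{p\in\mathbb{R}^n:|p|<1\}$ with metric $\frac{4}{(1-|p|^2)^2}\delta_{ij}$),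 $\partial_\infty\mathbb{H}^n$ is identified with the unit sphere $\partial B\subset\mathbb{R}^n$; for $X\subset\partial_\infty\mathbb{H}^n$, $H^r(X)=0$ means that the $r$-dimensional (Euclidean) Hausdorff measure of the image of $X$ in $\partial B$ is zero (this does not depend on the chosen model/center). *)

theory Defs
  imports "HOL-Analysis.Analysis"
begin

text \<open>Hyperbolic n-space in the Poincare ball model: the open unit ball of a
Euclidean space 'a with n = DIM('a), metric 4/(1-|p|^2)^2 times the Euclidean one.\<close>

definition hyp_space :: "'a::euclidean_space set" where
  "hyp_space = ball 0 1"

definition pderiv_dir :: "('a::euclidean_space \<Rightarrow> real) \<Rightarrow> 'a \<Rightarrow> 'a \<Rightarrow> real" where
  "pderiv_dir u v x = frechet_derivative u (at x) v"

definition C2_on :: "'a::euclidean_space set \<Rightarrow> ('a \<Rightarrow> real) \<Rightarrow> bool" where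
  "C2_on S u \<longleftrightarrow>
     (\<forall>x\<in>S. u differentiable (at x)) \<and>
     (\<forall>i\<in>Basis. \<forall>x\<in>S. pderiv_dir u i differentiable (at x)) \<and>
     (\<forall>i\<in>Basis. \<forall>j\<in>Basis. continuous_on S (pderiv_dir (pderiv_dir u i) j))"

definition eucl_laplacian :: "('a::euclidean_space \<Rightarrow> real) \<Rightarrow> 'a \<Rightarrow> real" where
  "eucl_laplacian u x = (\<Sum>i\<in>Basis. pderiv_dir (pderiv_dir u i) i x)"

text \<open>Laplace-Beltrami operator of the Poincare ball model:
  Delta u = ((1-|x|^2)/2)^2 Delta_E u + (n-2) (1-|x|^2)/2 <x, grad u>.\<close>
definition hyp_laplacian :: "('a::euclidean_space \<Rightarrow> real) \<Rightarrow> 'a \<Rightarrow> real" where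
  "hyp_laplacian u x =
     ((1 - (norm x)\<^sup>2) / 2)\<^sup>2 * eucl_laplacian u x
     + (real DIM('a) - 2) * ((1 - (norm x)\<^sup>2) / 2) * frechet_derivative u (at x) x"

text \<open>Bottom of the spectrum of H^n.\<close>
definition lambda1_hyp :: "'a::euclidean_space itself \<Rightarrow> real" where
  "lambda1_hyp _ = (real DIM('a) - 1)\<^sup>2 / 4"

definition hyp_domain :: "'a::euclidean_space set \<Rightarrow> bool" where
  "hyp_domain \<Omega> \<longleftrightarrow> \<Omega> \<subseteq> hyp_space \<and> open \<Omega> \<and> connected \<Omega> \<and> \<Omega> \<noteq> {}"

definition hyp_closure :: "'a::euclidean_space set \<Rightarrow> 'a set" where
  "hyp_closure \<Omega> = closure \<Omega> \<inter> hyp_space"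

definition hyp_boundary :: "'a::euclidean_space set \<Rightarrow> 'a set" where
  "hyp_boundary \<Omega> = frontier \<Omega> \<inter> hyp_space"

text \<open>Asymptotic boundary, in the ball model: the cone topology on the closed ball
  coincides with the Euclidean one, and the ideal boundary is the unit sphere.\<close>
definition asymp_boundary :: "'a::euclidean_space set \<Rightarrow> 'a set" where
  "asymp_boundary \<Omega> = closure \<Omega> \<inter> sphere 0 1"

definition lambda_harmonic :: "real \<Rightarrow> 'a::euclidean_space set \<Rightarrow> ('a \<Rightarrow> real) \<Rightarrow> bool" where
  "lambda_harmonic lam \<Omega> u \<longleftrightarrow>
     (\<exists>x\<in>hyp_closure \<Omega>. u x \<noteq> 0) \<and>
     continuous_on (hyp_closure \<Omega>) u \<and> C2_on \<Omega> u \<and>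
     (\<forall>x\<in>\<Omega>. - hyp_laplacian u x = lam * u x) \<and>
     (\<forall>x\<in>hyp_boundary \<Omega>. u x = 0)"

text \<open>Zero r-dimensional Hausdorff measure (Euclidean), r > 0:
  for every delta > 0 the delta-approximating content H^r_delta vanishes.
  (Normalising constants do not affect null sets.)\<close>
definition hausdorff_null :: "real \<Rightarrow> 'a::euclidean_space set \<Rightarrow> bool" where
  "hausdorff_null r X \<longleftrightarrow>
     (\<forall>\<delta>>0. \<forall>\<epsilon>>0. \<exists>C :: nat \<Rightarrow> 'a set.
        X \<subseteq> (\<Union>k. C k) \<and> (\<forall>k. bounded (C k) \<and> diameter (C k) \<le> \<delta>) \<and>
        summable (\<lambda>k. diameter (C k) powr r) \<and> (\<Sum>k. diameter (C k) powr r) < \<epsilon>)"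

end

theory Submission
  imports Defs
begin

text \<open>Let m = (n-1)/2, so that the bottom of the spectrum is m^2. For a point \<open>\<xi>\<close> of the unit
sphere and \<open>\<delta> > 0\<close> let L be the hyperbolic sine of the signed distance to the totally geodesic
hypersurface \<open>|x - \<xi>| = \<delta> |x + \<xi>|\<close>. Then \<open>\<Delta> L = n L\<close> and \<open>|\<nabla> L|^2 = L^2 + 1\<close>, from which
\<open>(L + 1)^(-m)\<close> is a strict supersolution of \<open>- \<Delta> v = m^2 v\<close> where \<open>L > n\<close>; at a fixed point it is
of order \<open>\<delta>^m\<close>. Cover the compact asymptotic boundary by finitely many balls around \<open>\<xi>_k\<close> of radius
\<open>\<delta>_k\<close> with small \<open>\<Sum> \<delta>_k^m\<close>, and let v be the sum of the associated barriers. The part of the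
closure of \<open>\<Omega>\<close> where all \<open>L_k \<ge> n\<close> is compact in the open ball, so u/v has a maximum there. It is
not attained at an interior point where u is positive, because v is a strict supersolution; it is not positive on
the boundary of \<open>\<Omega>\<close>, and v is bounded below where some \<open>L_k = n\<close>. Hence u is bounded above at each
point by a constant times \<open>\<Sum> \<delta>_k^m\<close>. The same holds for -u.\<close>

section \<open>Finite ball covers of compact Hausdorff null sets\<close>

text \<open>A covering set that meets \<open>X\<close> lies in any ball about one of its points with
  radius above its diameter, and compactness leaves finitely many balls. The set \<open>S\<close>
  keeps the centres on the unit sphere in the application.\<close>

lemma hausdorff_null_finite_ball_cover:
  fixes X S :: "'a::euclidean_space set"
  assumes null: "hausdorff_null r X" and r: "r > 0" and "compact X" and "X \<subseteq> S" "S \<noteq> {}"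
    and eps: "\<epsilon> > 0"
  obtains F :: "nat set" and \<xi> :: "nat \<Rightarrow> 'a" and \<delta> :: "nat \<Rightarrow> real"
  where "finite F" "F \<noteq> {}" "\<And>k. \<xi> k \<in> S" "\<And>k. \<delta> k > 0"
    "X \<subseteq> (\<Union>k\<in>F. ball (\<xi> k) (\<delta> k))" "(\<Sum>k\<in>F. \<delta> k powr r) < \<epsilon>"
proof -
  have "\<epsilon> / 2 > 0" using eps by simp
  then obtain C :: "nat \<Rightarrow> 'a set" where C: "X \<subseteq> (\<Union>k. C k)" "\<And>k. bounded (C k)"
      and sC: "summable (\<lambda>k. diameter (C k) powr r)" "(\<Sum>k. diameter (C k) powr r) < \<epsilon> / 2"
    using null unfolding hausdorff_null_def by (meson zero_less_one)
  \<comment> \<open>The added terms have total \<epsilon>/2. They make every radius positive, even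
    for sets of diameter 0, and strictly larger than the diameter.\<close>
  define a where "a k = diameter (C k) powr r + \<epsilon> / 2 * (1/2) ^ Suc k" for k
  define \<delta> where "\<delta> k = a k powr (1 / r)" for k
  obtain s0 where s0: "s0 \<in> S" using \<open>S \<noteq> {}\<close> by blast
  \<comment> \<open>Sets that miss \<open>X\<close> receive the default centre
    \<open>s0\<close>.\<close>
  have "\<exists>y\<in>S. X \<inter> C k \<noteq> {} \<longrightarrow> y \<in> C k" for k
    using s0 \<open>X \<subseteq> S\<close> by blast
  then obtain \<xi> where \<xi>: "\<And>k. \<xi> k \<in> S" "\<And>k. X \<inter> C k \<noteq> {} \<Longrightarrow> \<xi> k \<in> C k"
    by metis
  have a_gt: "diameter (C k) powr r < a k" for k
    using eps by (simp add: a_def)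
  have a_pos: "a k > 0" for k
    using a_gt[of k] powr_ge_zero[of "diameter (C k)" r] by linarith
  have \<delta>_pos: "\<delta> k > 0" for k
    using a_pos[of k] by (simp add: \<delta>_def)
  have \<delta>_powr: "\<delta> k powr r = a k" for k
    using a_pos[of k] r by (simp add: \<delta>_def powr_powr)
  have \<delta>_gt: "diameter (C k) < \<delta> k" for k
  proof -
    have "diameter (C k) = (diameter (C k) powr r) powr (1 / r)"
      using r diameter_ge_0[OF C(2)] by (simp add: powr_powr)
    also have "\<dots> < \<delta> k"
      unfolding \<delta>_def using r a_gt by (intro powr_less_mono2) auto
    finally show ?thesis .
  qed
  have cover: "X \<subseteq> (\<Union>k. ball (\<xi> k) (\<delta> k))"
  proof
    fix x assume "x \<in> X"
    then obtain k where k: "x \<in> C k" using C(1) by blast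
    then have "\<xi> k \<in> C k" using \<xi>(2) \<open>x \<in> X\<close> by blast
    then have "dist (\<xi> k) x \<le> diameter (C k)"
      using k C(2) diameter_bounded_bound by blast
    then show "x \<in> (\<Union>k. ball (\<xi> k) (\<delta> k))"
      using \<delta>_gt[of k] by (auto intro!: exI[of _ k])
  qed
  obtain F where F: "finite F" "X \<subseteq> (\<Union>k\<in>F. ball (\<xi> k) (\<delta> k))"
    using compactE_image[OF \<open>compact X\<close>, of UNIV "\<lambda>k. ball (\<xi> k) (\<delta> k)"] cover by auto
  have "(\<lambda>k. \<epsilon> / 2 * (1/2) ^ Suc k) sums (\<epsilon> / 2 * 1)"
    by (intro sums_mult power_half_series)
  then have "a sums ((\<Sum>k. diameter (C k) powr r) + \<epsilon> / 2)"
    unfolding a_def using sC(1) by (auto intro!: sums_add)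
  \<comment> \<open>Inserting the index 0 makes the index set nonempty; the bound survives because
    it holds for the whole series.\<close>
  then have "sum a (insert 0 F) \<le> (\<Sum>k. diameter (C k) powr r) + \<epsilon> / 2"
    using F(1) a_pos by (metis finite_insert less_imp_le sum_le_suminf sums_iff)
  then have "(\<Sum>k\<in>insert 0 F. \<delta> k powr r) < \<epsilon>"
    using sC(2) by (simp add: \<delta>_powr)
  with F \<xi>(1) \<delta>_pos show ?thesis
    by (intro that[of "insert 0 F" \<xi> \<delta>]) auto
qed

section \<open>Second derivative test in one variable\<close>

text \<open>The derivative vanishes at the maximum. If \<open>c\<close> were positive,
  \<open>g'\<close> would be positive just to the right of 0, and the mean value theorem would give
  values above \<open>g 0\<close>.\<close>

lemma second_derivative_nonpos_at_local_max:
  fixes g g' :: "real \<Rightarrow> real"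
  assumes d: "d > 0" and max: "\<And>t. \<bar>t\<bar> < d \<Longrightarrow> g t \<le> g 0"
    and g': "\<And>t. \<bar>t\<bar> < d \<Longrightarrow> (g has_real_derivative g' t) (at t)"
    and g'': "(g' has_real_derivative c) (at 0)"
  shows "c \<le> 0"
proof -
  have 0: "g' 0 = 0"
    using DERIV_local_max[OF g'[of 0] d] d max by simp
  show ?thesis
  proof (rule ccontr)
    assume "\<not> c \<le> 0"
    then obtain e where e: "e > 0" "\<And>h. 0 < h \<Longrightarrow> h < e \<Longrightarrow> g' 0 < g' h"
      using DERIV_pos_inc_right[OF g''] by auto
    define h where "h = min d e / 2"
    have h: "0 < h" "h < d" "h < e" using d e(1) by (auto simp: h_def)
    obtain z where "0 < z" "z < h" "g h - g 0 = (h - 0) * g' z"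
      using MVT2[of 0 h g g'] g' h by fastforce
    moreover have "g' z > 0" using e(2)[of z] 0 h \<open>0 < z\<close> \<open>z < h\<close> by simp
    ultimately have "g h > g 0" using h(1) by (metis diff_gt_0_iff_gt diff_zero mult_pos_pos)
    then show False using max[of h] h by simp
  qed
qed

section \<open>Restrictions of Lorentzian linear functions to the ball model\<close>

text \<open>In the hyperboloid model, \<open>lor c e \<xi>\<close> is the restriction of a linear function; it is the
hyperbolic sine of a signed distance when the normal vector is a unit spacelike vector, which is the
condition \<open>e^2 = c^2 + 1\<close> below.\<close>

definition lor :: "real \<Rightarrow> real \<Rightarrow> 'a::euclidean_space \<Rightarrow> 'a \<Rightarrow> real" where
  "lor c e \<xi> x = (c * (1 + x \<bullet> x) - 2 * e * (x \<bullet> \<xi>)) / (1 - x \<bullet> x)"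

text \<open>Closed forms in a direction \<open>d\<close> reduce the calculus for \<open>lor\<close>
  to one real variable along the lines \<open>x + t *\<^sub>R d\<close>.\<close>

definition lor_deriv :: "real \<Rightarrow> real \<Rightarrow> 'a::euclidean_space \<Rightarrow> 'a \<Rightarrow> 'a \<Rightarrow> real" where
  "lor_deriv c e \<xi> d x =
     (4 * (c - e * (x \<bullet> \<xi>)) * (x \<bullet> d) - 2 * e * (1 - x \<bullet> x) * (d \<bullet> \<xi>)) / (1 - x \<bullet> x)\<^sup>2"

definition lor_deriv2 :: "real \<Rightarrow> real \<Rightarrow> 'a::euclidean_space \<Rightarrow> 'a \<Rightarrow> 'a \<Rightarrow> real" where
  "lor_deriv2 c e \<xi> d x =
     (4 * (c - e * (x \<bullet> \<xi>)) * (d \<bullet> d) - 8 * e * (d \<bullet> \<xi>) * (x \<bullet> d)) / (1 - x \<bullet> x)\<^sup>2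
     + 16 * (c - e * (x \<bullet> \<xi>)) * (x \<bullet> d)\<^sup>2 / (1 - x \<bullet> x) ^ 3"

lemma DERIV_inner_self_line:
  fixes x d :: "'a::real_inner"
  shows "((\<lambda>t. (x + t *\<^sub>R d) \<bullet> (x + t *\<^sub>R d)) has_real_derivative 2 * ((x + t *\<^sub>R d) \<bullet> d)) (at t)"
proof -
  have "(\<lambda>t. (x + t *\<^sub>R d) \<bullet> (x + t *\<^sub>R d)) = (\<lambda>t. x \<bullet> x + 2 * t * (x \<bullet> d) + t\<^sup>2 * (d \<bullet> d))"
    by (auto simp: inner_add inner_commute algebra_simps power2_eq_square)
  then show ?thesis
    by (auto intro!: derivative_eq_intros simp: inner_add algebra_simps)
qed

lemma DERIV_inner_line:
  fixes x d y :: "'a::real_inner"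
  shows "((\<lambda>t. (x + t *\<^sub>R d) \<bullet> y) has_real_derivative d \<bullet> y) (at t)"
  unfolding inner_add inner_scaleR_left by (auto intro!: derivative_eq_intros)

lemma DERIV_lor_line:
  assumes "norm (x + t *\<^sub>R d) < 1"
  shows "((\<lambda>t. lor c e \<xi> (x + t *\<^sub>R d)) has_real_derivative lor_deriv c e \<xi> d (x + t *\<^sub>R d)) (at t)"
proof -
  define y where "y = x + t *\<^sub>R d"
  have D: "1 - y \<bullet> y \<noteq> 0"
    using assms by (simp add: y_def norm_lt_square)
  show ?thesis
    unfolding lor_def lor_deriv_def
    apply (rule derivative_eq_intros DERIV_inner_self_line DERIV_inner_line refl)+
    using D unfolding y_def[symmetric] by (auto simp: divide_simps power2_eq_square) algebra
qed

lemma DERIV_lor_deriv_line: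
  assumes "norm (x + t *\<^sub>R d) < 1"
  shows "((\<lambda>t. lor_deriv c e \<xi> d (x + t *\<^sub>R d)) has_real_derivative lor_deriv2 c e \<xi> d (x + t *\<^sub>R d)) (at t)"
proof -
  define y where "y = x + t *\<^sub>R d"
  have D: "1 - y \<bullet> y \<noteq> 0"
    using assms by (simp add: y_def norm_lt_square)
  show ?thesis
    unfolding lor_deriv_def lor_deriv2_def
    apply (rule derivative_eq_intros DERIV_inner_self_line DERIV_inner_line refl)+
    using D unfolding y_def[symmetric] by (auto simp: divide_simps power2_eq_square power3_eq_cube) algebra
qed

text \<open>The left side is the squared gradient in the hyperbolic metric. On the hyperboloid, a
  linear function L with unit spacelike normal has gradient of squared length L^2 + 1.\<close>

lemma lor_gradient_norm:
  fixes x \<xi> :: "'a::euclidean_space"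
  assumes "norm x < 1" "norm \<xi> = 1" "e\<^sup>2 = c\<^sup>2 + 1"
  shows "((1 - x \<bullet> x) / 2)\<^sup>2 * (\<Sum>i\<in>Basis. (lor_deriv c e \<xi> i x)\<^sup>2) = (lor c e \<xi> x)\<^sup>2 + 1"
proof -
  define r where "r = x \<bullet> x"
  define s where "s = x \<bullet> \<xi>"
  define k where "k = c - e * s"
  have D: "1 - r \<noteq> 0" using assms by (simp add: r_def norm_lt_square)
  have "\<xi> \<bullet> \<xi> = 1" using assms(2) by (simp add: norm_eq_1)
  have "(\<Sum>i\<in>Basis. (4 * k * (x \<bullet> i) - 2 * e * (1 - r) * (i \<bullet> \<xi>))\<^sup>2)
     = (\<Sum>i\<in>Basis. (4*k)\<^sup>2 * ((x \<bullet> i) * (x \<bullet> i)) - 16 * k * e * (1 - r) * ((x \<bullet> i) * (\<xi> \<bullet> i))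
          + (2 * e * (1 - r))\<^sup>2 * ((\<xi> \<bullet> i) * (\<xi> \<bullet> i)))"
    by (intro sum.cong refl) (simp add: inner_commute power2_eq_square algebra_simps)
  also have "\<dots> = (4*k)\<^sup>2 * (x \<bullet> x) - 16 * k * e * (1 - r) * (x \<bullet> \<xi>) + (2 * e * (1 - r))\<^sup>2 * (\<xi> \<bullet> \<xi>)"
    unfolding euclidean_inner[of x x] euclidean_inner[of x \<xi>] euclidean_inner[of \<xi> \<xi>]
    by (simp add: sum.distrib sum_subtractf sum_distrib_left)
  finally have S: "(\<Sum>i\<in>Basis. (lor_deriv c e \<xi> i x)\<^sup>2)
      = ((4*k)\<^sup>2 * r - 16 * k * e * (1 - r) * s + (2 * e * (1 - r))\<^sup>2) / (1 - r)^4"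
    unfolding lor_deriv_def r_def[symmetric] s_def[symmetric] k_def[symmetric]
    by (simp add: power_divide sum_divide_distrib[symmetric] \<open>\<xi> \<bullet> \<xi> = 1\<close> r_def s_def flip: power_mult)
  \<comment> \<open>By \<open>e\<^sup>2 = c\<^sup>2 + 1\<close> the last term on the left supplies
    the extra \<open>(1 - r)\<^sup>2\<close>, which becomes the summand 1 after division.\<close>
  have key: "(4*k)\<^sup>2 * r - 16 * k * e * (1 - r) * s + (2 * e * (1 - r))\<^sup>2
      = 4 * ((c * (1 + r) - 2 * e * s)\<^sup>2 + (1 - r)\<^sup>2)"
    unfolding k_def using assms(3) by algebra
  show ?thesis
    unfolding S key unfolding lor_def r_def[symmetric] s_def[symmetric]
    using D apply (simp add: divide_simps power_divide)
    by algebra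
qed

text \<open>Linear functions restricted to the hyperboloid are eigenfunctions of the Laplacian with
  \<Delta> L = n L. The left side is the formula of \<open>hyp_laplacian\<close> with the closed
  forms inserted.\<close>

lemma lor_laplacian:
  fixes x \<xi> :: "'a::euclidean_space"
  assumes "norm x < 1"
  shows "((1 - x \<bullet> x) / 2)\<^sup>2 * (\<Sum>i\<in>Basis. lor_deriv2 c e \<xi> i x)
      + (real DIM('a) - 2) * ((1 - x \<bullet> x) / 2) * lor_deriv c e \<xi> x x = real DIM('a) * lor c e \<xi> x"
proof -
  define r where "r = x \<bullet> x"
  define s where "s = x \<bullet> \<xi>"
  define k where "k = c - e * s"
  define n where "n = real DIM('a)"
  have D: "1 - r \<noteq> 0" using assms by (simp add: r_def norm_lt_square)
  have "(\<Sum>i\<in>Basis. lor_deriv2 c e \<xi> i x)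
     = (\<Sum>i\<in>Basis. 4 * k / (1 - r)\<^sup>2 - 8 * e / (1 - r)\<^sup>2 * ((x \<bullet> i) * (\<xi> \<bullet> i))
          + 16 * k / (1 - r)^3 * ((x \<bullet> i) * (x \<bullet> i)))"
    unfolding lor_deriv2_def r_def[symmetric] s_def[symmetric] k_def[symmetric]
    by (intro sum.cong refl) (simp add: inner_commute power2_eq_square diff_divide_distrib)
  also have "\<dots> = n * (4 * k / (1 - r)\<^sup>2) - 8 * e / (1 - r)\<^sup>2 * (x \<bullet> \<xi>) + 16 * k / (1 - r)^3 * (x \<bullet> x)"
    unfolding euclidean_inner[of x x] euclidean_inner[of x \<xi>] n_def
    by (simp add: sum.distrib sum_subtractf sum_distrib_left)
  finally have S: "(\<Sum>i\<in>Basis. lor_deriv2 c e \<xi> i x)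
     = n * (4 * k / (1 - r)\<^sup>2) - 8 * e / (1 - r)\<^sup>2 * s + 16 * k / (1 - r)^3 * r"
    by (simp add: r_def s_def)
  show ?thesis
    unfolding S unfolding lor_def lor_deriv_def n_def[symmetric] r_def[symmetric] s_def[symmetric]
    using D unfolding k_def
    apply (simp add: divide_simps power_divide)
    by algebra
qed

section \<open>Estimates for the function of a geodesic cap\<close>

text \<open>The coefficients are sinh and cosh of log (1/\<delta>). This form shows the zero set |x
  - \<xi>| = \<delta> |x + \<xi>| and makes the sign and the size readable.\<close>

lemma lor_geodesic_cap:
  fixes x \<xi> :: "'a::euclidean_space"
  assumes "norm \<xi> = 1" "\<delta> > 0"
  shows "lor ((1/\<delta> - \<delta>) / 2) ((1/\<delta> + \<delta>) / 2) \<xi> x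
    = ((norm (x - \<xi>))\<^sup>2 / \<delta> - \<delta> * (norm (x + \<xi>))\<^sup>2) / (2 * (1 - (norm x)\<^sup>2))"
proof -
  have 1: "(norm (x - \<xi>))\<^sup>2 = x \<bullet> x + 1 - 2 * (x \<bullet> \<xi>)" "(norm (x + \<xi>))\<^sup>2 = x \<bullet> x + 1 + 2 * (x \<bullet> \<xi>)"
    using assms(1) by (simp_all add: power2_norm_eq_inner inner_diff inner_add inner_commute norm_eq_1)
  have "c * (1 + x \<bullet> x) - 2 * e * (x \<bullet> \<xi>) = (a * (x \<bullet> x + 1 - 2 * (x \<bullet> \<xi>)) - b * (x \<bullet> x + 1 + 2 * (x \<bullet> \<xi>))) / 2"
    if "c = (a - b) / 2" "e = (a + b) / 2" for a b c e :: real
    unfolding that by (simp add: field_simps)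
  note num = this[OF refl refl, of "1/\<delta>" \<delta>]
  show ?thesis
    unfolding 1 lor_def power2_norm_eq_inner[of x] num by (simp only: divide_divide_eq_left) simp
qed

text \<open>In the ball, |x + \<xi>| > 2 - \<delta> \<ge> 1, hence |x - \<xi>|^2 / \<delta> <
  \<delta> \<le> \<delta> |x + \<xi>|^2. Thus a region where \<open>lor\<close> is nonnegative
  avoids the covering balls.\<close>

lemma lor_neg_near_center:
  fixes x \<xi> :: "'a::euclidean_space"
  assumes "norm \<xi> = 1" "0 < \<delta>" "\<delta> \<le> 1" "norm x < 1" "dist \<xi> x < \<delta>"
  shows "lor ((1/\<delta> - \<delta>) / 2) ((1/\<delta> + \<delta>) / 2) \<xi> x < 0"
proof -
  have d: "norm (x - \<xi>) < \<delta>" using assms(5) by (simp add: dist_norm norm_minus_commute)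
  have "norm (2 *\<^sub>R \<xi>) \<le> norm (x + \<xi>) + norm (x - \<xi>)"
    by (metis add_diff_cancel_left' add_diff_eq diff_diff_eq2 norm_triangle_ineq4 scaleR_2)
  then have "1 \<le> norm (x + \<xi>)" using d assms by simp
  then have "1 \<le> (norm (x + \<xi>))\<^sup>2" by simp
  then have 1: "\<delta> \<le> \<delta> * (norm (x + \<xi>))\<^sup>2" using assms(2) by simp
  have "(norm (x - \<xi>))\<^sup>2 < \<delta>\<^sup>2" using d by (intro power_strict_mono) auto
  then have "(norm (x - \<xi>))\<^sup>2 / \<delta> < \<delta>"
    using assms(2) by (simp add: divide_simps power2_eq_square)
  moreover have "(norm x)\<^sup>2 < 1" using assms(4) by (simp add: power_less_one_iff)
  ultimately show ?thesis unfolding lor_geodesic_cap[OF assms(1,2)]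
    using 1 by (intro divide_neg_pos) auto
qed

text \<open>With q = (1 - |x|)^2, the positive term of the numerator is at least q/\<delta> and the
  negative one at most 4\<delta>, which is at most half of that. So \<open>lor\<close> grows like
  1/\<delta> at a fixed point.\<close>

lemma lor_lower_bound:
  fixes x \<xi> :: "'a::euclidean_space"
  assumes "norm \<xi> = 1" "0 < \<delta>" "norm x < 1" "\<delta> \<le> (1 - norm x)\<^sup>2 / 4"
  shows "lor ((1/\<delta> - \<delta>) / 2) ((1/\<delta> + \<delta>) / 2) \<xi> x \<ge> (1 - norm x)\<^sup>2 / (4 * \<delta>)"
proof -
  define q where "q = (1 - norm x)\<^sup>2"
  have q: "0 < q" "q \<le> 1" using assms(3) by (auto simp: q_def power_le_one)
  have "1 - norm x \<le> norm (x - \<xi>)" using norm_triangle_ineq2[of \<xi> x] assms by (simp add: norm_minus_commute)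
  then have "q \<le> (norm (x - \<xi>))\<^sup>2" unfolding q_def using assms(3) by (intro power_mono) auto
  then have 1: "q / \<delta> \<le> (norm (x - \<xi>))\<^sup>2 / \<delta>" using assms(2) by (simp add: divide_simps)
  have "norm (x + \<xi>) \<le> 2" using norm_triangle_ineq[of x \<xi>] assms by simp
  then have "(norm (x + \<xi>))\<^sup>2 \<le> 2\<^sup>2" by (intro power_mono) auto
  then have "\<delta> * (norm (x + \<xi>))\<^sup>2 \<le> \<delta> * 4" using assms(2) by simp
  also have "\<delta> * 4 \<le> q / (2 * \<delta>)"
  proof -
    have "\<delta> * \<delta> \<le> (q / 4) * (1 / 4)"
      using assms q by (intro mult_mono) (auto simp: q_def[symmetric])
    also have "\<dots> \<le> q / 8" using q by simp
    finally show ?thesis using assms(2) by (simp add: divide_simps)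
  qed
  finally have 2: "q / (2 * \<delta>) \<le> (norm (x - \<xi>))\<^sup>2 / \<delta> - \<delta> * (norm (x + \<xi>))\<^sup>2"
    using 1 by simp
  have D: "0 < 1 - (norm x)\<^sup>2" "1 - (norm x)\<^sup>2 \<le> 1" using assms(3) by (auto simp: power_less_one_iff)
  \<comment> \<open>Since q/(2\<delta>) is positive, dividing it by
    \<open>2 * (1 - (norm x)\<^sup>2)\<close>, which is at most 2, gives at least half of
    it.\<close>
  have "q / (4 * \<delta>) = (q / (2 * \<delta>)) / 2" by simp
  also have "\<dots> \<le> (q / (2 * \<delta>)) / (2 * (1 - (norm x)\<^sup>2))"
    using D q assms(2) by (intro divide_left_mono) auto
  also have "\<dots> \<le> ((norm (x - \<xi>))\<^sup>2 / \<delta> - \<delta> * (norm (x + \<xi>))\<^sup>2) / (2 * (1 - (norm x)\<^sup>2))"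
    using D by (intro divide_right_mono 2) auto
  finally show ?thesis unfolding lor_geodesic_cap[OF assms(1,2)] q_def .
qed

section \<open>Barriers\<close>

text \<open>The shift by 1 matters: without it, \<open>L^(-m)\<close> satisfies the reverse inequality (it is a strict subsolution).\<close>

definition barrier :: "real \<Rightarrow> real \<Rightarrow> real \<Rightarrow> 'a::euclidean_space \<Rightarrow> 'a \<Rightarrow> real" where
  "barrier m c e \<xi> x = (lor c e \<xi> x + 1) powr (- m)"

definition barrier_deriv :: "real \<Rightarrow> real \<Rightarrow> real \<Rightarrow> 'a::euclidean_space \<Rightarrow> 'a \<Rightarrow> 'a \<Rightarrow> real" where
  "barrier_deriv m c e \<xi> d x = - m * (lor c e \<xi> x + 1) powr (- m - 1) * lor_deriv c e \<xi> d x"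

definition barrier_deriv2 :: "real \<Rightarrow> real \<Rightarrow> real \<Rightarrow> 'a::euclidean_space \<Rightarrow> 'a \<Rightarrow> 'a \<Rightarrow> real" where
  "barrier_deriv2 m c e \<xi> d x =
     m * (m + 1) * (lor c e \<xi> x + 1) powr (- m - 2) * (lor_deriv c e \<xi> d x)\<^sup>2
     - m * (lor c e \<xi> x + 1) powr (- m - 1) * lor_deriv2 c e \<xi> d x"

lemma DERIV_barrier_line:
  assumes "norm (x + t *\<^sub>R d) < 1" "lor c e \<xi> (x + t *\<^sub>R d) + 1 > 0"
  shows "((\<lambda>t. barrier m c e \<xi> (x + t *\<^sub>R d)) has_real_derivative barrier_deriv m c e \<xi> d (x + t *\<^sub>R d)) (at t)"
  unfolding barrier_def barrier_deriv_def using assms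
  by (auto intro!: derivative_eq_intros DERIV_lor_line)

lemma DERIV_barrier_deriv_line:
  assumes "norm (x + t *\<^sub>R d) < 1" "lor c e \<xi> (x + t *\<^sub>R d) + 1 > 0"
  shows "((\<lambda>t. barrier_deriv m c e \<xi> d (x + t *\<^sub>R d)) has_real_derivative barrier_deriv2 m c e \<xi> d (x + t *\<^sub>R d)) (at t)"
proof -
  have "- m - 1 - 1 = - m - 2" by simp
  then show ?thesis
    unfolding barrier_deriv_def barrier_deriv2_def using assms
    by (auto intro!: derivative_eq_intros DERIV_lor_line DERIV_lor_deriv_line
        simp: power2_eq_square algebra_simps)
qed

text \<open>For M = L + 1 the chain rule, |\<nabla> L|^2 = (M - 1)^2 + 1 and \<Delta> L = (2m + 1)(M
  - 1) give -m^2 M^(-m) + m M^(-m-2) (2m + 2 - M). The last factor is negative exactly when L > 2m +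
  1 = n.\<close>

lemma barrier_strict_supersolution:
  fixes x \<xi> :: "'a::euclidean_space"
  defines "m \<equiv> (real DIM('a) - 1) / 2"
  assumes "DIM('a) \<ge> 2" "norm x < 1" "norm \<xi> = 1" "e\<^sup>2 = c\<^sup>2 + 1" "lor c e \<xi> x > real DIM('a)"
  shows "((1 - x \<bullet> x) / 2)\<^sup>2 * (\<Sum>i\<in>Basis. barrier_deriv2 m c e \<xi> i x)
      + (real DIM('a) - 2) * ((1 - x \<bullet> x) / 2) * barrier_deriv m c e \<xi> x x
      < - m\<^sup>2 * barrier m c e \<xi> x"
proof -
  define M where "M = lor c e \<xi> x + 1"
  \<comment> \<open>All powers of \<open>M\<close> are multiples of \<open>p\<close> by polynomials
    in \<open>M\<close>, so the rest is polynomial arithmetic.\<close>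
  define p where "p = M powr (- m - 2)"
  define n where "n = real DIM('a)"
  define W where "W = (1 - x \<bullet> x) / 2"
  have n: "n = 2 * m + 1" "n \<ge> 2" using assms(2) by (simp_all add: n_def m_def field_simps)
  then have m: "m > 0" by simp
  have M: "M > 2 * m + 2" using assms(6) n by (simp add: M_def n_def[symmetric])
  then have M0: "M > 0" using m by simp
  then have p: "p > 0" by (simp add: p_def)
  have p1: "M powr (- m - 1) = M * p"
  proof -
    have "1 + (- m - 2) = - m - 1" by simp
    from powr_add[of M 1 "- m - 2", unfolded this] show ?thesis
      unfolding p_def using M0 by (simp only: powr_one less_imp_le)
  qed
  have p2: "M powr (- m) = M\<^sup>2 * p"
    unfolding p_def using M0 powr_add[of M 2 "- m - 2"] by (simp add: powr_numeral)
  have g: "W\<^sup>2 * (\<Sum>i\<in>Basis. (lor_deriv c e \<xi> i x)\<^sup>2) = (M - 1)\<^sup>2 + 1"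
    using lor_gradient_norm[OF assms(3-5)] by (simp add: M_def W_def)
  have l: "W\<^sup>2 * (\<Sum>i\<in>Basis. lor_deriv2 c e \<xi> i x) + (n - 2) * W * lor_deriv c e \<xi> x x = n * (M - 1)"
    using lor_laplacian[OF assms(3), of c e \<xi>] by (simp add: M_def W_def n_def)
  have "W\<^sup>2 * (\<Sum>i\<in>Basis. barrier_deriv2 m c e \<xi> i x) + (n - 2) * W * barrier_deriv m c e \<xi> x x
    = m * (m + 1) * p * (W\<^sup>2 * (\<Sum>i\<in>Basis. (lor_deriv c e \<xi> i x)\<^sup>2))
      - m * (M * p) * (W\<^sup>2 * (\<Sum>i\<in>Basis. lor_deriv2 c e \<xi> i x) + (n - 2) * W * lor_deriv c e \<xi> x x)"
    unfolding barrier_deriv2_def barrier_deriv_def M_def[symmetric] p1 p_def[symmetric]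
    by (simp only: sum_subtractf sum_distrib_left[symmetric]) (simp add: algebra_simps)
  also have "\<dots> = - m\<^sup>2 * (M\<^sup>2 * p) + m * p * (2 * m + 2 - M)"
    unfolding g l unfolding n(1) by (simp add: power2_eq_square algebra_simps)
  also have "\<dots> < - m\<^sup>2 * (M\<^sup>2 * p)"
    using m p M by (simp add: mult_pos_neg)
  finally show ?thesis
    unfolding barrier_def M_def[symmetric] p2 W_def n_def .
qed

section \<open>Comparison at a maximum\<close>

lemma DERIV_pderiv_dir_line:
  assumes "f differentiable (at (x + t *\<^sub>R d))"
  shows "((\<lambda>t. f (x + t *\<^sub>R d)) has_real_derivative pderiv_dir f d (x + t *\<^sub>R d)) (at t)"
proof -
  define f' where "f' = frechet_derivative f (at (x + t *\<^sub>R d))"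
  have f': "(f has_derivative f') (at (x + t *\<^sub>R d))"
    using assms by (simp add: f'_def frechet_derivative_works)
  have "((\<lambda>t. x + t *\<^sub>R d) has_derivative (\<lambda>h. h *\<^sub>R d)) (at t)"
    by (auto intro!: derivative_eq_intros)
  from has_derivative_compose[OF this f']
  have "((\<lambda>t. f (x + t *\<^sub>R d)) has_derivative (\<lambda>h. f' (h *\<^sub>R d))) (at t)" .
  moreover have "(\<lambda>h. f' (h *\<^sub>R d)) = (*) (f' d)"
    using has_derivative_linear[OF f'] by (auto simp: linear_cmul)
  ultimately show ?thesis
    by (simp add: has_field_derivative_def f'_def pderiv_dir_def)
qed

text \<open>Along each line through \<open>x\<close>, \<open>u - v\<close> has a maximum at
  \<open>t = 0\<close>: first derivatives agree and second derivatives are ordered. The first-order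
  term of the Laplacian is a derivative in direction \<open>x\<close>, so it is the same for both
  functions. Only derivatives of \<open>v\<close> along lines enter.\<close>

lemma hyp_laplacian_le_at_local_max:
  fixes u v :: "'a::euclidean_space \<Rightarrow> real"
  assumes C2: "C2_on S u" and r: "r > 0" "ball x r \<subseteq> S" and "norm x < 1"
    and max: "\<And>y. y \<in> ball x r \<Longrightarrow> u y - v y \<le> u x - v x"
    and v1: "\<And>d t. x + t *\<^sub>R d \<in> ball x r \<Longrightarrow>
        ((\<lambda>t. v (x + t *\<^sub>R d)) has_real_derivative v1 d (x + t *\<^sub>R d)) (at t)"
    and v2: "\<And>d. ((\<lambda>t. v1 d (x + t *\<^sub>R d)) has_real_derivative v2 d) (at 0)"
  shows "hyp_laplacian u x \<le> ((1 - x \<bullet> x) / 2)\<^sup>2 * (\<Sum>i\<in>Basis. v2 i)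
      + (real DIM('a) - 2) * ((1 - x \<bullet> x) / 2) * v1 x x"
proof -
  have u1: "((\<lambda>t. u (x + t *\<^sub>R d)) has_real_derivative pderiv_dir u d (x + t *\<^sub>R d)) (at t)"
    if "x + t *\<^sub>R d \<in> ball x r" for d t
    using C2 r that by (intro DERIV_pderiv_dir_line) (auto simp: C2_on_def)
  \<comment> \<open>The \<open>+ 1\<close> covers \<open>d = 0\<close>, which occurs for the
    direction \<open>d = x\<close> at the origin.\<close>
  have near: "x + t *\<^sub>R d \<in> ball x r" if "\<bar>t\<bar> < r / (norm d + 1)" for t d
  proof -
    have "\<bar>t\<bar> * norm d \<le> \<bar>t\<bar> * (norm d + 1)" by (simp add: mult_left_mono)
    also have "\<dots> < r" using that by (simp add: pos_less_divide_eq add_nonneg_pos)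
    finally show ?thesis by (simp add: dist_norm)
  qed
  have rd: "r / (norm d + 1) > 0" for d :: 'a
    using r(1) by (simp add: add_nonneg_pos)
  have lmax: "u (x + t *\<^sub>R d) - v (x + t *\<^sub>R d) \<le> u (x + 0 *\<^sub>R d) - v (x + 0 *\<^sub>R d)"
    if "\<bar>t\<bar> < r / (norm d + 1)" for t d
    using max[OF near[OF that]] by simp
  have D1: "((\<lambda>t. u (x + t *\<^sub>R d) - v (x + t *\<^sub>R d)) has_real_derivative
      pderiv_dir u d (x + t *\<^sub>R d) - v1 d (x + t *\<^sub>R d)) (at t)"
    if "\<bar>t\<bar> < r / (norm d + 1)" for t d
    by (intro DERIV_diff u1 v1 near that)
  have "pderiv_dir u x (x + 0 *\<^sub>R x) - v1 x (x + 0 *\<^sub>R x) = 0"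
    by (rule DERIV_local_max[OF D1 rd[of x]]) (use rd[of x] lmax in auto)
  then have grad: "frechet_derivative u (at x) x = v1 x x"
    by (simp add: pderiv_dir_def)
  have "pderiv_dir (pderiv_dir u i) i x \<le> v2 i" if "i \<in> Basis" for i
  proof -
    have "pderiv_dir u i differentiable (at (x + 0 *\<^sub>R i))"
      using C2 r that by (auto simp: C2_on_def subset_iff)
    from DERIV_diff[OF DERIV_pderiv_dir_line[OF this] v2[of i]]
    have "((\<lambda>t. pderiv_dir u i (x + t *\<^sub>R i) - v1 i (x + t *\<^sub>R i)) has_real_derivative
        pderiv_dir (pderiv_dir u i) i (x + 0 *\<^sub>R i) - v2 i) (at 0)" .
    from second_derivative_nonpos_at_local_max[OF rd lmax D1 this]
    show ?thesis by simp
  qed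
  then have "eucl_laplacian u x \<le> (\<Sum>i\<in>Basis. v2 i)"
    unfolding eucl_laplacian_def by (rule sum_mono)
  then show ?thesis
    unfolding hyp_laplacian_def grad power2_norm_eq_inner
    by (intro add_right_mono mult_left_mono) auto
qed

text \<open>The constant comes from the faces where some L_k = n: there \<open>u\<close> is at most
  \<open>B\<close> and the barrier sum is at least (n + 1)^(-m). Elsewhere a larger quotient
  contradicts the strict supersolution property.\<close>

lemma bounded_eigenfunction_le_barrier_sum:
  fixes \<Omega> :: "'a::euclidean_space set" and \<xi> :: "'k \<Rightarrow> 'a" and \<delta> :: "'k \<Rightarrow> real"
  defines "n \<equiv> real DIM('a)"
  defines "m \<equiv> (n - 1) / 2"
  defines "c \<equiv> \<lambda>k. (1/\<delta> k - \<delta> k) / 2" and "e \<equiv> \<lambda>k. (1/\<delta> k + \<delta> k) / 2"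
  assumes dim: "DIM('a) \<ge> 2" and \<Omega>: "\<Omega> \<subseteq> ball 0 1" "open \<Omega>"
    and cont: "continuous_on (hyp_closure \<Omega>) u" and C2: "C2_on \<Omega> u"
    and eq: "\<And>x. x \<in> \<Omega> \<Longrightarrow> - hyp_laplacian u x = lam * u x"
    and zero: "\<And>x. x \<in> hyp_boundary \<Omega> \<Longrightarrow> u x = 0"
    and lam: "lam \<le> m\<^sup>2"
    and bound: "\<And>x. x \<in> \<Omega> \<Longrightarrow> u x \<le> B" and "B \<ge> 0"
    and F: "finite F" "F \<noteq> {}" and \<xi>: "\<And>k. k \<in> F \<Longrightarrow> norm (\<xi> k) = 1"
    and \<delta>: "\<And>k. k \<in> F \<Longrightarrow> 0 < \<delta> k" "\<And>k. k \<in> F \<Longrightarrow> \<delta> k \<le> 1"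
    and cover: "asymp_boundary \<Omega> \<subseteq> (\<Union>k\<in>F. ball (\<xi> k) (\<delta> k))"
    and x0: "x0 \<in> \<Omega>" "\<And>k. k \<in> F \<Longrightarrow> n \<le> lor (c k) (e k) (\<xi> k) x0"
  shows "u x0 \<le> B * (n + 1) powr m * (\<Sum>k\<in>F. barrier m (c k) (e k) (\<xi> k) x0)"
proof -
  define L where "L k = lor (c k) (e k) (\<xi> k)" for k
  define v where "v x = (\<Sum>k\<in>F. barrier m (c k) (e k) (\<xi> k) x)" for x
  define A where "A = {x \<in> hyp_closure \<Omega>. \<forall>k\<in>F. n \<le> L k x}"
  have n: "n \<ge> 2" using dim by (simp add: n_def)
  have m: "m > 0" using n by (simp add: m_def)
  have ce: "(e k)\<^sup>2 = (c k)\<^sup>2 + 1" if "k \<in> F" for k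
    using \<delta>(1)[OF that] by (simp add: c_def e_def field_simps power2_eq_square)
  have contL: "continuous_on (ball 0 1) (L k)" for k
  proof -
    have "1 - x \<bullet> x \<noteq> 0" if "x \<in> ball 0 1" for x :: 'a
      using that by (simp add: norm_lt_square)
    then show ?thesis
      unfolding L_def lor_def by (intro continuous_intros) auto
  qed
  \<comment> \<open>Removing the balls leaves a compact set that misses the unit sphere.
    \<open>A\<close> is a closed part of it, since every L_k is negative on its ball inside the unit
    ball.\<close>
  define T where "T = closure \<Omega> - (\<Union>k\<in>F. ball (\<xi> k) (\<delta> k))"
  have "bounded \<Omega>" using \<Omega>(1) bounded_ball bounded_subset by blast
  then have T: "compact T"
    unfolding T_def by (intro compact_diff) (auto simp: compact_closure)
  have "closure \<Omega> \<subseteq> cball 0 1"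
    using closure_mono[OF \<Omega>(1)] by simp
  have T_sub: "T \<subseteq> ball 0 1"
  proof
    fix x assume x: "x \<in> T"
    then have "norm x \<le> 1" using \<open>closure \<Omega> \<subseteq> cball 0 1\<close> by (auto simp: T_def)
    moreover have "norm x \<noteq> 1"
      using x cover by (auto simp: T_def asymp_boundary_def)
    ultimately show "x \<in> ball 0 1" by simp
  qed
  have "A = T \<inter> (\<Inter>k\<in>F. {x \<in> T. n \<le> L k x})"
  proof (intro equalityI subsetI)
    fix x assume x: "x \<in> A"
    have "x \<notin> ball (\<xi> k) (\<delta> k)" if "k \<in> F" for k
    proof
      assume "x \<in> ball (\<xi> k) (\<delta> k)"
      then have "L k x < 0" unfolding L_def c_def e_def
        using x \<xi>[OF that] \<delta>[OF that]
        by (intro lor_neg_near_center) (auto simp: A_def hyp_closure_def hyp_space_def)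
      with x that n show False unfolding A_def by force
    qed
    then show "x \<in> T \<inter> (\<Inter>k\<in>F. {x \<in> T. n \<le> L k x})"
      using x by (auto simp: A_def T_def hyp_closure_def)
  next
    fix x assume x: "x \<in> T \<inter> (\<Inter>k\<in>F. {x \<in> T. n \<le> L k x})"
    then show "x \<in> A"
      using T_sub by (auto simp: A_def T_def hyp_closure_def hyp_space_def)
  qed
  moreover have "closed {x \<in> T. n \<le> L k x}" for k
    using continuous_on_subset[OF contL T_sub] T
    by (intro continuous_on_closed_Collect_le continuous_on_const compact_imp_closed)
  ultimately have "compact A"
    using T by (metis (no_types, lifting) closed_INT compact_Int_closed)
  have x0A: "x0 \<in> A"
    using x0 \<Omega>(1) closure_subset by (auto simp: A_def hyp_closure_def hyp_space_def L_def)
  have A_ball: "A \<subseteq> ball 0 1" by (auto simp: A_def hyp_closure_def hyp_space_def)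
  have contv: "continuous_on A v"
    unfolding v_def barrier_def L_def[symmetric]
  proof (intro continuous_on_sum continuous_on_powr continuous_on_add continuous_on_const ballI)
    fix k assume "k \<in> F"
    show "continuous_on A (L k)" by (rule continuous_on_subset[OF contL A_ball])
    fix x assume "x \<in> A"
    then have "n \<le> L k x" using \<open>k \<in> F\<close> by (auto simp: A_def)
    then show "L k x + 1 \<noteq> 0" using n by simp
  qed
  have barrier_pos: "barrier m (c k) (e k) (\<xi> k) x > 0" if "x \<in> A" "k \<in> F" for x k
  proof -
    have "n \<le> L k x" using that by (auto simp: A_def)
    then have "L k x + 1 > 0" using n by simp
    then show ?thesis by (simp add: barrier_def L_def)
  qed
  have v_pos: "v x > 0" if "x \<in> A" for x
    unfolding v_def using F barrier_pos that by (intro sum_pos) auto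
  have "continuous_on A (\<lambda>x. u x / v x)"
  proof (intro continuous_on_divide contv ballI)
    show "continuous_on A u"
      by (rule continuous_on_subset[OF cont]) (auto simp: A_def)
    show "v x \<noteq> 0" if "x \<in> A" for x using v_pos[OF that] by simp
  qed
  then obtain x1 where x1: "x1 \<in> A" and x1max: "\<And>x. x \<in> A \<Longrightarrow> u x / v x \<le> u x1 / v x1"
    using continuous_attains_sup[OF \<open>compact A\<close>, of "\<lambda>x. u x / v x"] x0A by blast
  define q where "q = u x1 / v x1"
  have "q \<le> B * (n + 1) powr m"
  proof (rule ccontr)
    assume "\<not> q \<le> B * (n + 1) powr m"
    then have q: "q > B * (n + 1) powr m" by simp
    moreover have "B * (n + 1) powr m \<ge> 0" using \<open>B \<ge> 0\<close> by simp
    ultimately have "q > 0" by linarith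
    then have ux1: "u x1 > 0" using v_pos[OF x1] by (simp add: q_def zero_less_divide_iff)
    have x1\<Omega>: "x1 \<in> \<Omega>"
    proof (rule ccontr)
      assume "x1 \<notin> \<Omega>"
      then have "x1 \<in> hyp_boundary \<Omega>"
        using x1 \<Omega>(2) by (auto simp: A_def hyp_closure_def hyp_boundary_def frontier_def interior_open)
      then show False using zero ux1 by force
    qed
    have Lgt: "L k x1 > n" if k: "k \<in> F" for k
    proof (rule ccontr)
      assume "\<not> L k x1 > n"
      then have "L k x1 = n" using x1 k by (force simp: A_def)
      then have "(n + 1) powr (- m) = barrier m (c k) (e k) (\<xi> k) x1"
        by (simp add: barrier_def L_def)
      also have "\<dots> \<le> v x1" unfolding v_def
        using F(1) k barrier_pos[OF x1] by (intro member_le_sum) (auto intro: less_imp_le)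
      finally have "B * (n + 1) powr m * (n + 1) powr (- m) \<le> B * (n + 1) powr m * v x1"
        using \<open>B \<ge> 0\<close> by (intro mult_left_mono) auto
      moreover have "(n + 1) powr m * (n + 1) powr (- m) = 1"
        using n by (simp flip: powr_add)
      ultimately have "B \<le> B * (n + 1) powr m * v x1" by (simp add: mult.assoc)
      also have "\<dots> < q * v x1" using q v_pos[OF x1] by simp
      also have "\<dots> = u x1" using v_pos[OF x1] by (simp add: q_def)
      finally show False using bound[OF x1\<Omega>] by simp
    qed
    \<comment> \<open>With all inequalities strict, \<open>G\<close> is an open neighbourhood of
      \<open>x1\<close> inside \<open>A\<close>, so the maximum over \<open>A\<close> is a local
      maximum in the ordinary sense.\<close>
    define G where "G = \<Omega> \<inter> (\<Inter>k\<in>F. {x \<in> ball 0 1. n < L k x})"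
    have "open {x \<in> ball 0 1. n < L k x}" for k
    proof -
      have "{x \<in> ball 0 1. n < L k x} = ball 0 1 \<inter> L k -` {n<..}" by auto
      then show ?thesis using continuous_open_preimage[OF contL open_ball, of "{n<..}"] by simp
    qed
    then have "open G" unfolding G_def
      using F(1) \<Omega>(2) by (intro open_Int open_INT) auto
    moreover have "x1 \<in> G" using x1\<Omega> Lgt \<Omega>(1) by (auto simp: G_def)
    ultimately obtain r where r: "r > 0" "ball x1 r \<subseteq> G"
      using open_contains_ball by blast
    have G_A: "G \<subseteq> A"
      using \<Omega>(1) closure_subset by (fastforce simp: G_def A_def hyp_closure_def hyp_space_def)
    have G_L: "norm x < 1" "L k x + 1 > 0" if "x \<in> G" "k \<in> F" for x k
      using that n by (force simp: G_def)+
    have nx1: "norm x1 < 1" using x1 A_ball by auto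
    \<comment> \<open>On \<open>A\<close> the function \<open>q * v\<close> lies above
      \<open>u\<close> and touches it at \<open>x1\<close>, so \<open>u - q * v\<close> has a local
      maximum there.\<close>
    have "hyp_laplacian u x1 \<le> ((1 - x1 \<bullet> x1) / 2)\<^sup>2 *
        (\<Sum>i\<in>Basis. q * (\<Sum>k\<in>F. barrier_deriv2 m (c k) (e k) (\<xi> k) i x1))
      + (real DIM('a) - 2) * ((1 - x1 \<bullet> x1) / 2) * (q * (\<Sum>k\<in>F. barrier_deriv m (c k) (e k) (\<xi> k) x1 x1))"
    proof (rule hyp_laplacian_le_at_local_max[OF C2 r(1) _ nx1, where v = "\<lambda>x. q * v x"
            and ?v1.0 = "\<lambda>d x. q * (\<Sum>k\<in>F. barrier_deriv m (c k) (e k) (\<xi> k) d x)"])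
      show "ball x1 r \<subseteq> \<Omega>" using r(2) by (auto simp: G_def)
      fix y assume "y \<in> ball x1 r"
      then have "y \<in> A" using r(2) G_A by auto
      then have "u y \<le> q * v y"
        using x1max[of y] v_pos[of y] by (simp add: q_def[symmetric] pos_divide_le_eq)
      moreover have "u x1 = q * v x1" using v_pos[OF x1] by (simp add: q_def)
      ultimately show "u y - q * v y \<le> u x1 - q * v x1" by simp
    next
      fix d t assume "x1 + t *\<^sub>R d \<in> ball x1 r"
      then have "x1 + t *\<^sub>R d \<in> G" using r(2) by blast
      then show "((\<lambda>t. q * v (x1 + t *\<^sub>R d)) has_real_derivative
          q * (\<Sum>k\<in>F. barrier_deriv m (c k) (e k) (\<xi> k) d (x1 + t *\<^sub>R d))) (at t)"
        unfolding v_def using G_L unfolding L_def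
        by (intro DERIV_cmult DERIV_sum DERIV_barrier_line) auto
    next
      fix d
      show "((\<lambda>t. q * (\<Sum>k\<in>F. barrier_deriv m (c k) (e k) (\<xi> k) d (x1 + t *\<^sub>R d))) has_real_derivative
          q * (\<Sum>k\<in>F. barrier_deriv2 m (c k) (e k) (\<xi> k) d x1)) (at 0)"
      proof (intro DERIV_cmult DERIV_sum)
        fix k assume "k \<in> F"
        then show "((\<lambda>t. barrier_deriv m (c k) (e k) (\<xi> k) d (x1 + t *\<^sub>R d)) has_real_derivative
            barrier_deriv2 m (c k) (e k) (\<xi> k) d x1) (at 0)"
          using DERIV_barrier_deriv_line[of x1 0 d "c k" "e k" "\<xi> k" m] G_L[OF \<open>x1 \<in> G\<close>]
          by (simp add: L_def)
      qed
    qed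
    also have "\<dots> = q * (\<Sum>k\<in>F. ((1 - x1 \<bullet> x1) / 2)\<^sup>2 * (\<Sum>i\<in>Basis. barrier_deriv2 m (c k) (e k) (\<xi> k) i x1)
      + (real DIM('a) - 2) * ((1 - x1 \<bullet> x1) / 2) * barrier_deriv m (c k) (e k) (\<xi> k) x1 x1)"
      unfolding sum_distrib_left[symmetric] sum.swap[of _ F Basis]
      by (simp only: sum.distrib sum_distrib_left[symmetric] distrib_left mult.left_commute[of q])
    also have "\<dots> < q * (\<Sum>k\<in>F. - m\<^sup>2 * barrier m (c k) (e k) (\<xi> k) x1)"
    proof (intro mult_strict_left_mono \<open>q > 0\<close> sum_strict_mono F)
      fix k assume k: "k \<in> F"
      show "((1 - x1 \<bullet> x1) / 2)\<^sup>2 * (\<Sum>i\<in>Basis. barrier_deriv2 m (c k) (e k) (\<xi> k) i x1)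
          + (real DIM('a) - 2) * ((1 - x1 \<bullet> x1) / 2) * barrier_deriv m (c k) (e k) (\<xi> k) x1 x1
          < - m\<^sup>2 * barrier m (c k) (e k) (\<xi> k) x1"
        using barrier_strict_supersolution[OF dim nx1 \<xi>[OF k] ce[OF k]] Lgt[OF k]
        by (simp add: L_def m_def n_def)
    qed
    also have "\<dots> = - m\<^sup>2 * (q * v x1)" by (simp add: v_def sum_distrib_left mult.left_commute)
    also have "q * v x1 = u x1" using v_pos[OF x1] by (simp add: q_def)
    finally have "hyp_laplacian u x1 < - m\<^sup>2 * u x1" .
    moreover have "hyp_laplacian u x1 = - lam * u x1" using eq[OF x1\<Omega>] by simp
    \<comment> \<open>Positivity of \<open>u x1\<close> turns the spectral bound into the inequality
      that contradicts strictness.\<close>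
    moreover have "lam * u x1 \<le> m\<^sup>2 * u x1" using lam ux1 by (intro mult_right_mono) auto
    ultimately show False by simp
  qed
  moreover have "u x0 \<le> q * v x0"
    using x1max[OF x0A] v_pos[OF x0A] by (simp add: q_def[symmetric] pos_divide_le_eq)
  ultimately have "u x0 \<le> B * (n + 1) powr m * v x0"
    using v_pos[OF x0A] by (meson less_imp_le mult_right_mono order_trans)
  then show ?thesis by (simp add: v_def)
qed

section \<open>Shrinking the cover\<close>

text \<open>At the fixed point \<open>x0\<close> the barrier of radius \<delta> is at most
  (4\<delta>/q)^m, so the comparison bounds \<open>u x0\<close> by a fixed multiple of the sum of
  the \<delta>^m, which is arbitrarily small.\<close>

lemma bounded_eigenfunction_nonpos:
  fixes \<Omega> :: "'a::euclidean_space set"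
  assumes dim: "DIM('a) \<ge> 2" and \<Omega>: "\<Omega> \<subseteq> ball 0 1" "open \<Omega>"
    and null: "hausdorff_null ((real DIM('a) - 1) / 2) (asymp_boundary \<Omega>)"
    and cont: "continuous_on (hyp_closure \<Omega>) u" and C2: "C2_on \<Omega> u"
    and eq: "\<And>x. x \<in> \<Omega> \<Longrightarrow> - hyp_laplacian u x = lam * u x"
    and zero: "\<And>x. x \<in> hyp_boundary \<Omega> \<Longrightarrow> u x = 0"
    and lam: "lam \<le> lambda1_hyp TYPE('a)"
    and bound: "\<And>x. x \<in> \<Omega> \<Longrightarrow> u x \<le> B" and "B \<ge> 0" and x0: "x0 \<in> \<Omega>"
  shows "u x0 \<le> 0"
proof -
  define n where "n = real DIM('a)"
  define m where "m = (n - 1) / 2"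
  define q where "q = (1 - norm x0)\<^sup>2"
  \<comment> \<open>Radii up to \<eta> satisfy q/(4\<delta>) \<ge> n, which puts \<open>x0\<close>
    in the comparison region; \<eta> is also below the threshold q/4 of
    \<open>lor_lower_bound\<close>.\<close>
  define \<eta> where "\<eta> = q / (4 * n)"
  define K where "K = B * (n + 1) powr m * (4 / q) powr m"
  have n: "n \<ge> 2" using dim by (simp add: n_def)
  have m: "m > 0" using n by (simp add: m_def)
  have nx0: "norm x0 < 1" using x0 \<Omega>(1) by auto
  have q: "0 < q" "q \<le> 1" using nx0 by (auto simp: q_def power_le_one)
  have \<eta>: "\<eta> > 0" "\<eta> \<le> q / 4" using q n by (auto simp: \<eta>_def field_simps)
  have "compact (asymp_boundary \<Omega>)"
    unfolding asymp_boundary_def by (intro closed_Int_compact) auto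
  have "u x0 \<le> K * \<epsilon>" if \<epsilon>: "0 < \<epsilon>" "\<epsilon> < \<eta> powr m" for \<epsilon>
  proof -
    obtain F :: "nat set" and \<xi> :: "nat \<Rightarrow> 'a" and \<delta> :: "nat \<Rightarrow> real"
      where F: "finite F" "F \<noteq> {}" and \<xi>: "\<And>k. \<xi> k \<in> sphere 0 1" and \<delta>: "\<And>k. \<delta> k > 0"
        and cover: "asymp_boundary \<Omega> \<subseteq> (\<Union>k\<in>F. ball (\<xi> k) (\<delta> k))"
        and small: "(\<Sum>k\<in>F. \<delta> k powr m) < \<epsilon>"
    proof (rule hausdorff_null_finite_ball_cover[OF null _ \<open>compact (asymp_boundary \<Omega>)\<close> _ _ \<epsilon>(1), of "sphere 0 1"])
      show "0 < (real DIM('a) - 1) / 2" using m by (simp add: m_def n_def)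
      show "asymp_boundary \<Omega> \<subseteq> sphere 0 1" by (simp add: asymp_boundary_def)
    qed (auto simp: m_def n_def)
    have \<xi>1: "norm (\<xi> k) = 1" for k using \<xi>[of k] by simp
    \<comment> \<open>A single term is bounded by the whole sum, so \<epsilon> < \<eta>^m controls
      each radius.\<close>
    have \<delta>_le: "\<delta> k \<le> \<eta>" if "k \<in> F" for k
    proof (rule ccontr)
      assume "\<not> \<delta> k \<le> \<eta>"
      then have "\<eta> powr m \<le> \<delta> k powr m" using \<eta>(1) m by (intro powr_mono2) auto
      also have "\<dots> \<le> (\<Sum>k\<in>F. \<delta> k powr m)" using F(1) that by (intro member_le_sum) auto
      finally show False using small \<epsilon>(2) by simp
    qed
    let ?c = "\<lambda>k. (1/\<delta> k - \<delta> k) / 2" and ?e = "\<lambda>k. (1/\<delta> k + \<delta> k) / 2"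
    have L: "q / (4 * \<delta> k) \<le> lor (?c k) (?e k) (\<xi> k) x0" if "k \<in> F" for k
      unfolding q_def using \<delta>_le[OF that] \<eta>(2)
      by (intro lor_lower_bound \<xi>1 \<delta> nx0) (simp add: q_def)
    have "n \<le> lor (?c k) (?e k) (\<xi> k) x0" if "k \<in> F" for k
    proof -
      have "n \<le> q / (4 * \<delta> k)"
        using \<delta>_le[OF that] \<delta>[of k] n by (simp add: \<eta>_def field_simps)
      then show ?thesis using L[OF that] by simp
    qed
    then have "u x0 \<le> B * (n + 1) powr m * (\<Sum>k\<in>F. barrier m (?c k) (?e k) (\<xi> k) x0)"
      unfolding m_def n_def
      using lam \<delta>_le \<eta>(2) q(2)
      by (intro bounded_eigenfunction_le_barrier_sum[OF dim \<Omega> cont C2 eq zero _ bound \<open>B \<ge> 0\<close> F \<xi>1 \<delta> _ cover x0])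
        (force simp: lambda1_hyp_def power_divide)+
    also have "\<dots> \<le> B * (n + 1) powr m * (\<Sum>k\<in>F. (4 / q) powr m * \<delta> k powr m)"
    proof (intro mult_left_mono sum_mono)
      fix k assume k: "k \<in> F"
      \<comment> \<open>Dropping the shift by 1 lowers the base and, as the exponent is negative,
        raises the power.\<close>
      have "barrier m (?c k) (?e k) (\<xi> k) x0 \<le> (q / (4 * \<delta> k)) powr (- m)"
        unfolding barrier_def using L[OF k] q \<delta>[of k] m by (intro powr_mono2') auto
      also have "\<dots> = (4 / q * \<delta> k) powr m"
        using q \<delta>[of k] by (simp add: powr_minus powr_divide powr_mult field_simps)
      also have "\<dots> = (4 / q) powr m * \<delta> k powr m"
        using q \<delta>[of k] by (simp only: powr_mult)
      finally show "barrier m (?c k) (?e k) (\<xi> k) x0 \<le> (4 / q) powr m * \<delta> k powr m" .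
    qed (use \<open>B \<ge> 0\<close> in auto)
    also have "\<dots> = K * (\<Sum>k\<in>F. \<delta> k powr m)"
      by (simp add: K_def sum_distrib_left mult.assoc)
    also have "\<dots> \<le> K * \<epsilon>"
      using small \<open>B \<ge> 0\<close> by (intro mult_left_mono) (auto simp: K_def)
    finally show ?thesis .
  qed
  then have "eventually (\<lambda>\<epsilon>. u x0 \<le> K * \<epsilon>) (at_right 0)"
    using \<eta>(1) by (auto simp: eventually_at_right_field intro!: exI[of _ "\<eta> powr m"])
  moreover have "((\<lambda>\<epsilon>. K * \<epsilon>) \<longlongrightarrow> K * 0) (at_right 0)"
    by (intro tendsto_intros)
  ultimately show ?thesis
    using tendsto_lowerbound[of "\<lambda>\<epsilon>. K * \<epsilon>" "K * 0" "at_right 0" "u x0"] by simp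
qed

section \<open>Change of sign and conclusion\<close>

lemma pderiv_dir_uminus:
  assumes "f differentiable (at x)"
  shows "pderiv_dir (\<lambda>y. - f y) d x = - pderiv_dir f d x"
proof -
  have "((\<lambda>y. - f y) has_derivative (\<lambda>h. - frechet_derivative f (at x) h)) (at x)"
    using assms by (intro has_derivative_minus) (simp add: frechet_derivative_works)
  then show ?thesis
    unfolding pderiv_dir_def using frechet_derivative_at by metis
qed

text \<open>The first derivatives of \<open>- u\<close> are known to be those of \<open>u\<close>
  negated only on the open set where \<open>u\<close> is differentiable; locality suffices for
  differentiating once more.\<close>

lemma differentiable_on_open_cong:
  assumes "f differentiable (at x)" "open S" "x \<in> S" "\<And>y. y \<in> S \<Longrightarrow> f y = g y"
  shows "g differentiable (at x)" "pderiv_dir g d x = pderiv_dir f d x"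
proof -
  have "(g has_derivative frechet_derivative f (at x)) (at x)"
    using assms by (intro has_derivative_transform_within_open[of f _ x UNIV S g])
      (simp_all add: frechet_derivative_works)
  then show "g differentiable (at x)" "pderiv_dir g d x = pderiv_dir f d x"
    unfolding pderiv_dir_def differentiable_def using frechet_derivative_at by metis+
qed

lemma
  assumes "open S" "C2_on S u"
  shows C2_on_uminus: "C2_on S (\<lambda>x. - u x)"
    and hyp_laplacian_uminus: "x \<in> S \<Longrightarrow> hyp_laplacian (\<lambda>x. - u x) x = - hyp_laplacian u x"
proof -
  have u: "u differentiable (at x)" if "x \<in> S" for x
    using assms that by (auto simp: C2_on_def)
  have du: "pderiv_dir u i differentiable (at x)" if "x \<in> S" "i \<in> Basis" for x i
    using assms that by (auto simp: C2_on_def)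
  have mdu: "(\<lambda>y. - pderiv_dir u i y) differentiable (at x)" if "x \<in> S" "i \<in> Basis" for x i
    using du[OF that] by (rule differentiable_minus)
  have d1: "- pderiv_dir u i y = pderiv_dir (\<lambda>x. - u x) i y" if "y \<in> S" for y i
    using pderiv_dir_uminus[OF u[OF that]] by simp
  have d2: "pderiv_dir (pderiv_dir (\<lambda>x. - u x) i) j x = - pderiv_dir (pderiv_dir u i) j x"
    if "x \<in> S" "i \<in> Basis" for x i j
    using differentiable_on_open_cong(2)[OF mdu[OF that] assms(1) that(1) d1]
      pderiv_dir_uminus[OF du[OF that]] by simp
  show "C2_on S (\<lambda>x. - u x)"
    unfolding C2_on_def
  proof (intro conjI ballI)
    show "(\<lambda>x. - u x) differentiable (at x)" if "x \<in> S" for x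
      using u[OF that] by (rule differentiable_minus)
    show "pderiv_dir (\<lambda>x. - u x) i differentiable (at x)" if "i \<in> Basis" "x \<in> S" for i x
      using differentiable_on_open_cong(1)[OF mdu[OF that(2,1)] assms(1) that(2) d1] .
    show "continuous_on S (pderiv_dir (pderiv_dir (\<lambda>x. - u x) i) j)" if "i \<in> Basis" "j \<in> Basis" for i j
    proof -
      have "continuous_on S (\<lambda>x. - pderiv_dir (pderiv_dir u i) j x)"
        using assms(2) that by (intro continuous_on_minus) (auto simp: C2_on_def)
      then show ?thesis by (rule continuous_on_eq) (simp add: d2 that)
    qed
  qed
  show "hyp_laplacian (\<lambda>x. - u x) x = - hyp_laplacian u x" if "x \<in> S"
  proof -
    have "eucl_laplacian (\<lambda>x. - u x) x = - eucl_laplacian u x"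
      unfolding eucl_laplacian_def by (simp add: d2 that sum_negf)
    moreover have "frechet_derivative (\<lambda>x. - u x) (at x) x = - frechet_derivative u (at x) x"
      using pderiv_dir_uminus[OF u[OF that], of x] by (simp add: pderiv_dir_def)
    ultimately show ?thesis unfolding hyp_laplacian_def by simp
  qed
qed

theorem theorem1:
  fixes \<Omega> :: "'a::euclidean_space set" and lam :: real and u :: "'a \<Rightarrow> real"
  assumes "DIM('a) \<ge> 2"
    and "hyp_domain \<Omega>" and "\<Omega> \<noteq> hyp_space"
    and "hausdorff_null ((real DIM('a) - 1) / 2) (asymp_boundary \<Omega>)"
    and "0 \<le> lam" and "lam \<le> lambda1_hyp TYPE('a)"
  shows "\<not> (lambda_harmonic lam \<Omega> u \<and> bounded (u ` \<Omega>))"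
proof
  assume H: "lambda_harmonic lam \<Omega> u \<and> bounded (u ` \<Omega>)"
  then have cont: "continuous_on (hyp_closure \<Omega>) u" and C2: "C2_on \<Omega> u"
    and eq: "\<And>x. x \<in> \<Omega> \<Longrightarrow> - hyp_laplacian u x = lam * u x"
    and zero: "\<And>x. x \<in> hyp_boundary \<Omega> \<Longrightarrow> u x = 0"
    by (auto simp: lambda_harmonic_def)
  have \<Omega>: "\<Omega> \<subseteq> ball 0 1" "open \<Omega>"
    using assms(2) by (auto simp: hyp_domain_def hyp_space_def)
  obtain B where "B > 0" and B: "\<And>x. x \<in> \<Omega> \<Longrightarrow> \<bar>u x\<bar> \<le> B"
    using H by (auto simp: bounded_pos)
  have "u x \<le> 0" if "x \<in> \<Omega>" for x
    using B \<open>B > 0\<close> that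
    by (intro bounded_eigenfunction_nonpos[OF assms(1) \<Omega> assms(4) cont C2 eq zero assms(6), of B])
      (auto simp: abs_le_iff)
  moreover have "- u x \<le> 0" if "x \<in> \<Omega>" for x
    using B \<open>B > 0\<close> that cont eq zero
    by (intro bounded_eigenfunction_nonpos[OF assms(1) \<Omega> assms(4) _ C2_on_uminus[OF \<Omega>(2) C2] _ _ assms(6), of B])
      (auto simp: abs_le_iff hyp_laplacian_uminus[OF \<Omega>(2) C2] intro!: continuous_intros)
  ultimately have "u x = 0" if "x \<in> \<Omega>" for x using that by force
  \<comment> \<open>Nontriviality is asked on the relative closure, so its points outside \<Omega>
    are treated by the boundary condition.\<close>
  moreover have "u x = 0" if "x \<in> hyp_closure \<Omega>" "x \<notin> \<Omega>" for x
    using that \<Omega>(2) zero by (auto simp: hyp_closure_def hyp_boundary_def frontier_def interior_open)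
  ultimately show False using H by (auto simp: lambda_harmonic_def)
qed

end
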